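(* Let $\mathcal{H}$ be a separable complex Hilbert space, let $\Psi=(\psi_n)_{n\in\Gamma}$ be a sequence of elements in $\mathcal{H}$, and let $\mathbf{w}=(w_n)_{n\in\Gamma}$ be a sequence of positive, semi-normalized weights. Then the following properties are equivalent: 1. $(\psi_n)$ is a frame. 2. $\mathbf{M}_{\mathbf{w},\Psi}$ is a positive and invertible operator. 3. There are constants $m>0$ and $M<\infty$ such that $$m\|f\|^2\le\sum_{n\in\Gamma} w_n|\langle f,\psi_n\rangle|^2\le M\|f\|^2\qquad\text{for all } f\in\mathcal{H},$$ i.e. the pair $(w_n),(\psi_n)$ forms a w-frame. 4. $(\sqrt{w_n}\,\psi_n)$ is a frame. 5. $\mathbf{M}_{\mathbf{w}',\Psi}$ is a positive and invertible operator for any (i.e. every) positive, semi-normalized sequence $\mathbf{w}'=(w_n')_{n\in\Gamma}$. 6. $(w_n\psi_n)$ is a frame, i.e. the pair $(w_n),(\psi_n)$ forms a weighted frame.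
   Context: The inner product $\langle\cdot,\cdot\rangle$ is linear in the first coordinate. $\Gamma$ is a countable index set (series are taken with respect to a fixed enumeration). A sequence $(\psi_n)_{n\in\Gamma}$ in $\mathcal{H}$ is a frame if there are constants $m>0$, $M<\infty$ with $m\|f\|^2 \le \sum_{n} |\langle f,\psi_n\rangle|^2 \le M\|f\|^2$ for all $f\in\mathcal{H}$. A sequence $(c_n)$ of scalars is semi-normalized if there are constants $b\ge a>0$ with $a\le|c_n|\le b$ for all $n$; it is positive if $c_n>0$ for all $n$. For a scalar sequence $\mathbf{m}=(m_n)$, the multiplier is $\mathbf{M}_{\mathbf{m},\Psi}f=\sum_{n} m_n\langle f,\psi_n\rangle\psi_n$. The assertion that "$\mathbf{M}_{\mathbf{m},\Psi}$ is a positive and invertible operator" means that this series converges in $\mathcal{H}$ for every $f\in\mathcal{H}$ and defines a bounded operator $T$ on $\mathcal{H}$ with bounded inverse such that $\langle Tf,f\rangle>0$ for all $f\ne0$. *)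

theory Defs
  imports "HOL-Analysis.Analysis"
begin

(* Complex inner product spaces.  Real scaling, norm and topology come from real_normed_vector
   and are tied to the complex structure by scaleR_scaleC and norm_eq_sqrt_cinner.
   The inner product is linear in its first argument. *)
class complex_inner = real_normed_vector +
  fixes scaleC :: "complex \<Rightarrow> 'a \<Rightarrow> 'a"  (infixr "*\<^sub>C" 75)
    and cinner :: "'a \<Rightarrow> 'a \<Rightarrow> complex"
  assumes scaleC_add_right: "c *\<^sub>C (x + y) = c *\<^sub>C x + c *\<^sub>C y"
    and scaleC_add_left: "(c + d) *\<^sub>C x = c *\<^sub>C x + d *\<^sub>C x"
    and scaleC_scaleC: "c *\<^sub>C (d *\<^sub>C x) = (c * d) *\<^sub>C x"
    and scaleC_one: "1 *\<^sub>C x = x"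
    and scaleR_scaleC: "r *\<^sub>R x = complex_of_real r *\<^sub>C x"
    and cinner_commute: "cinner x y = cnj (cinner y x)"
    and cinner_add_left: "cinner (x + y) z = cinner x z + cinner y z"
    and cinner_scaleC_left: "cinner (c *\<^sub>C x) y = c * cinner x y"
    and cinner_ge_zero: "0 \<le> Re (cinner x x)"
    and cinner_eq_zero_iff: "cinner x x = 0 \<longleftrightarrow> x = 0"
    and norm_eq_sqrt_cinner: "norm x = sqrt (Re (cinner x x))"

class complex_hilbert_space = complex_inner + complete_space

instantiation complex :: complex_hilbert_space
begin

definition scaleC_complex :: "complex \<Rightarrow> complex \<Rightarrow> complex"
  where "scaleC_complex c x = c * x"

definition cinner_complex :: "complex \<Rightarrow> complex \<Rightarrow> complex"
  where "cinner_complex x y = x * cnj y"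

instance
  by standard
    (auto simp: scaleC_complex_def cinner_complex_def algebra_simps scaleR_conv_of_real
      cmod_def power2_eq_square)

end

definition separable :: "'a::topological_space set \<Rightarrow> bool"
  where "separable S \<longleftrightarrow> (\<exists>D. countable D \<and> D \<subseteq> S \<and> S \<subseteq> closure D)"

definition bounded_clinear :: "('a::complex_inner \<Rightarrow> 'b::complex_inner) \<Rightarrow> bool"
  where "bounded_clinear T \<longleftrightarrow> bounded_linear T \<and> (\<forall>c x. T (c *\<^sub>C x) = c *\<^sub>C T x)"

definition invertible_op :: "('a::complex_inner \<Rightarrow> 'a) \<Rightarrow> bool"
  where "invertible_op T \<longleftrightarrow>
    bounded_clinear T \<and> (\<exists>S. bounded_clinear S \<and> (\<forall>x. S (T x) = x) \<and> (\<forall>x. T (S x) = x))"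

definition positive_op :: "('a::complex_inner \<Rightarrow> 'a) \<Rightarrow> bool"
  where "positive_op T \<longleftrightarrow> (\<forall>f. f \<noteq> 0 \<longrightarrow> cinner (T f) f \<in> \<real> \<and> 0 < Re (cinner (T f) f))"

(* Series over a countable (finite or infinite) index set, in the order of an enumeration e
   without repetitions.  For a finite index set the series is padded with zeros. *)
definition enum_dom :: "'i set \<Rightarrow> nat set"
  where "enum_dom \<Gamma> = (if finite \<Gamma> then {..<card \<Gamma>} else UNIV)"

definition enumerates :: "(nat \<Rightarrow> 'i) \<Rightarrow> 'i set \<Rightarrow> bool"
  where "enumerates e \<Gamma> \<longleftrightarrow> bij_betw e (enum_dom \<Gamma>) \<Gamma>"

definition enum_terms :: "(nat \<Rightarrow> 'i) \<Rightarrow> 'i set \<Rightarrow> ('i \<Rightarrow> 'b::zero) \<Rightarrow> nat \<Rightarrow> 'b"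
  where "enum_terms e \<Gamma> x k = (if k \<in> enum_dom \<Gamma> then x (e k) else 0)"

definition summable_enum :: "(nat \<Rightarrow> 'i) \<Rightarrow> 'i set \<Rightarrow> ('i \<Rightarrow> 'b::real_normed_vector) \<Rightarrow> bool"
  where "summable_enum e \<Gamma> x \<longleftrightarrow> summable (enum_terms e \<Gamma> x)"

definition suminf_enum :: "(nat \<Rightarrow> 'i) \<Rightarrow> 'i set \<Rightarrow> ('i \<Rightarrow> 'b::real_normed_vector) \<Rightarrow> 'b"
  where "suminf_enum e \<Gamma> x = suminf (enum_terms e \<Gamma> x)"

(* The upper bound M < \<infinity> includes convergence of the series of nonnegative terms; this has to be
   demanded explicitly since suminf is a total function on real sequences. *)
definition is_frame :: "(nat \<Rightarrow> 'i) \<Rightarrow> 'i set \<Rightarrow> ('i \<Rightarrow> 'a::complex_inner) \<Rightarrow> bool"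
  where "is_frame e \<Gamma> \<psi> \<longleftrightarrow> (\<exists>m M. 0 < m \<and> (\<forall>f.
    summable_enum e \<Gamma> (\<lambda>n. (cmod (cinner f (\<psi> n)))\<^sup>2) \<and>
    m * (norm f)\<^sup>2 \<le> suminf_enum e \<Gamma> (\<lambda>n. (cmod (cinner f (\<psi> n)))\<^sup>2) \<and>
    suminf_enum e \<Gamma> (\<lambda>n. (cmod (cinner f (\<psi> n)))\<^sup>2) \<le> M * (norm f)\<^sup>2))"

definition is_w_frame :: "(nat \<Rightarrow> 'i) \<Rightarrow> 'i set \<Rightarrow> ('i \<Rightarrow> real) \<Rightarrow> ('i \<Rightarrow> 'a::complex_inner) \<Rightarrow> bool"
  where "is_w_frame e \<Gamma> w \<psi> \<longleftrightarrow> (\<exists>m M. 0 < m \<and> (\<forall>f.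
    summable_enum e \<Gamma> (\<lambda>n. w n * (cmod (cinner f (\<psi> n)))\<^sup>2) \<and>
    m * (norm f)\<^sup>2 \<le> suminf_enum e \<Gamma> (\<lambda>n. w n * (cmod (cinner f (\<psi> n)))\<^sup>2) \<and>
    suminf_enum e \<Gamma> (\<lambda>n. w n * (cmod (cinner f (\<psi> n)))\<^sup>2) \<le> M * (norm f)\<^sup>2))"

definition semi_normalized :: "'i set \<Rightarrow> ('i \<Rightarrow> 'b::real_normed_vector) \<Rightarrow> bool"
  where "semi_normalized \<Gamma> c \<longleftrightarrow>
    (\<exists>a b. 0 < a \<and> a \<le> b \<and> (\<forall>n\<in>\<Gamma>. a \<le> norm (c n) \<and> norm (c n) \<le> b))"

definition positive_seq :: "'i set \<Rightarrow> ('i \<Rightarrow> real) \<Rightarrow> bool"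
  where "positive_seq \<Gamma> c \<longleftrightarrow> (\<forall>n\<in>\<Gamma>. 0 < c n)"

definition multiplier_terms ::
  "('i \<Rightarrow> complex) \<Rightarrow> ('i \<Rightarrow> 'a::complex_inner) \<Rightarrow> 'a \<Rightarrow> 'i \<Rightarrow> 'a"
  where "multiplier_terms m \<psi> f n = (m n * cinner f (\<psi> n)) *\<^sub>C \<psi> n"

(* meaningful only where the series converges, cf. multiplier_converges *)
definition multiplier ::
  "(nat \<Rightarrow> 'i) \<Rightarrow> 'i set \<Rightarrow> ('i \<Rightarrow> complex) \<Rightarrow> ('i \<Rightarrow> 'a::complex_inner) \<Rightarrow> 'a \<Rightarrow> 'a"
  where "multiplier e \<Gamma> m \<psi> f = suminf_enum e \<Gamma> (multiplier_terms m \<psi> f)"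

definition multiplier_converges ::
  "(nat \<Rightarrow> 'i) \<Rightarrow> 'i set \<Rightarrow> ('i \<Rightarrow> complex) \<Rightarrow> ('i \<Rightarrow> 'a::complex_inner) \<Rightarrow> bool"
  where "multiplier_converges e \<Gamma> m \<psi> \<longleftrightarrow> (\<forall>f. summable_enum e \<Gamma> (multiplier_terms m \<psi> f))"

definition multiplier_positive_invertible ::
  "(nat \<Rightarrow> 'i) \<Rightarrow> 'i set \<Rightarrow> ('i \<Rightarrow> complex) \<Rightarrow> ('i \<Rightarrow> 'a::complex_inner) \<Rightarrow> bool"
  where "multiplier_positive_invertible e \<Gamma> m \<psi> \<longleftrightarrow>
    multiplier_converges e \<Gamma> m \<psi> \<and>
    positive_op (multiplier e \<Gamma> m \<psi>) \<and> invertible_op (multiplier e \<Gamma> m \<psi>)"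

end

theory Submission
  imports Defs
begin

text \<open>
  Everything reduces to one classical fact: a sequence is a frame if and only if its frame operator
  \<open>S f = (\<Sum>k. \<langle>f, \<phi>\<^sub>k\<rangle> \<phi>\<^sub>k)\<close> converges everywhere and is positive and invertible
  (\<open>frame_seq_iff_frame_operator\<close>).  Since \<open>w\<^sub>n \<langle>f, \<psi>\<^sub>n\<rangle> \<psi>\<^sub>n = \<langle>f, \<surd>w\<^sub>n \<psi>\<^sub>n\<rangle> \<surd>w\<^sub>n \<psi>\<^sub>n\<close>, the multiplier with
  positive weights \<open>w\<close> is the frame operator of the sequence \<open>\<surd>w\<^sub>n \<psi>\<^sub>n\<close>, and the w-frame inequality is
  the frame inequality of that same sequence.  On the other hand, rescaling the members of a sequence
  by scalars bounded above and away from zero changes each term \<open>\<bar>\<langle>f, \<psi>\<^sub>n\<rangle>\<bar>\<^sup>2\<close> only by a bounded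
  factor, so it preserves the frame property in both directions
  (\<open>is_frame_scale_semi_normalized\<close>).  This applies to the factors \<open>w\<^sub>n\<close> and \<open>\<surd>w\<^sub>n\<close> for
  every admissible weight \<open>w\<close>.

  The classical fact rests on the estimate \<open>\<parallel>\<Sum>\<^sub>F c\<^sub>k \<phi>\<^sub>k\<parallel>\<^sup>2 \<le> M \<Sum>\<^sub>F \<bar>c\<^sub>k\<bar>\<^sup>2\<close> for finite \<open>F\<close>
  (\<open>norm_synthesis_le\<close>), valid whenever \<open>M\<close> is an upper frame bound.  Applied to tails, it yields
  convergence of \<open>S f\<close>; in the limit it yields \<open>\<parallel>S f\<parallel>\<^sup>2 \<le> M \<langle>S f, f\<rangle>\<close>.  For a frame,
  \<open>\<langle>S f, f\<rangle> \<ge> m \<parallel>f\<parallel>\<^sup>2\<close> makes \<open>f \<mapsto> f - t (S f - g)\<close> a contraction for small \<open>t\<close>, whose fixed point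
  solves \<open>S f = g\<close>.  Conversely, if \<open>S\<close> has a bounded inverse with constant \<open>K\<close>, then
  \<open>\<parallel>f\<parallel>\<^sup>2 \<le> K\<^sup>2 \<parallel>S f\<parallel>\<^sup>2 \<le> K\<^sup>2 M \<langle>S f, f\<rangle>\<close>, which is the lower frame inequality.
\<close>

section \<open>Complex inner products\<close>

lemma cinner_zero_left [simp]: "cinner 0 (y::'a::complex_inner) = 0"
  using cinner_add_left[of 0 0 y] by simp

lemma cinner_zero_right [simp]: "cinner (x::'a::complex_inner) 0 = 0"
  by (subst cinner_commute) simp

lemma cinner_add_right: "cinner (x::'a::complex_inner) (y + z) = cinner x y + cinner x z"
  by (metis cinner_add_left cinner_commute complex_cnj_add)

lemma cinner_scaleC_right: "cinner (x::'a::complex_inner) (c *\<^sub>C y) = cnj c * cinner x y"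
  by (metis cinner_scaleC_left cinner_commute complex_cnj_mult)

lemma cinner_scaleR_left: "cinner (r *\<^sub>R (x::'a::complex_inner)) y = of_real r * cinner x y"
  by (simp add: scaleR_scaleC cinner_scaleC_left)

lemma cinner_scaleR_right: "cinner (x::'a::complex_inner) (r *\<^sub>R y) = of_real r * cinner x y"
  by (simp add: scaleR_scaleC cinner_scaleC_right)

lemma cinner_minus_left: "cinner (- (x::'a::complex_inner)) y = - cinner x y"
  using cinner_scaleR_left[of "-1" x y] by simp

lemma cinner_minus_right: "cinner (x::'a::complex_inner) (- y) = - cinner x y"
  using cinner_scaleR_right[of x "-1" y] by simp

lemma cinner_diff_left: "cinner ((x::'a::complex_inner) - y) z = cinner x z - cinner y z"
  using cinner_add_left[of x "- y" z] by (simp add: cinner_minus_left)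

lemma cinner_diff_right: "cinner (x::'a::complex_inner) (y - z) = cinner x y - cinner x z"
  using cinner_add_right[of x y "- z"] by (simp add: cinner_minus_right)

lemma cinner_sum_left: "cinner (sum f A) (y::'a::complex_inner) = (\<Sum>k\<in>A. cinner (f k) y)"
  by (induction A rule: infinite_finite_induct) (simp_all add: cinner_add_left)

lemma cinner_self: "cinner x x = of_real ((norm (x::'a::complex_inner))\<^sup>2)"
proof -
  have "Im (cinner x x) = 0"
    using arg_cong[OF cinner_commute[of x x], of Im] by simp
  then show ?thesis
    by (simp add: complex_eq_iff norm_eq_sqrt_cinner cinner_ge_zero)
qed

lemma norm_scaleC: "norm (c *\<^sub>C (x::'a::complex_inner)) = cmod c * norm x"
proof -
  have "complex_of_real ((norm (c *\<^sub>C x))\<^sup>2) = of_real ((cmod c * norm x)\<^sup>2)"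
    unfolding cinner_self[symmetric] cinner_scaleC_left cinner_scaleC_right
    by (simp add: cinner_self power_mult_distrib complex_norm_square mult_ac
        del: of_real_power flip: of_real_power)
  then show ?thesis
    by (metis abs_norm_cancel abs_mult norm_ge_zero of_real_eq_iff power2_eq_iff_nonneg
        mult_nonneg_nonneg)
qed

lemma norm_diff_square:
  "(norm ((x::'a::complex_inner) - y))\<^sup>2 = (norm x)\<^sup>2 - 2 * Re (cinner x y) + (norm y)\<^sup>2"
proof -
  have "(norm (x - y))\<^sup>2 = Re (cinner (x - y) (x - y))"
    by (simp add: cinner_self)
  also have "\<dots> = Re (cinner x x) - Re (cinner x y) - Re (cinner y x) + Re (cinner y y)"
    by (simp add: cinner_diff_left cinner_diff_right)
  also have "Re (cinner y x) = Re (cinner x y)"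
    by (subst cinner_commute) simp
  finally show ?thesis
    by (simp add: cinner_self)
qed

text \<open>The usual argument: the component of \<open>x\<close> orthogonal to \<open>y\<close> has nonnegative norm.  It is taken
  multiplied by \<open>(norm y)\<^sup>2\<close> to avoid a division.\<close>

lemma cmod_cinner_le: "cmod (cinner x y) \<le> norm x * norm (y::'a::complex_inner)"
proof (cases "y = 0")
  case False
  define N where "N = (norm y)\<^sup>2"
  define p where "p = cinner x y"
  have N: "N > 0" using False by (simp add: N_def)
  have "0 \<le> (norm (N *\<^sub>R x - p *\<^sub>C y))\<^sup>2" by simp
  also have "\<dots> = (N * norm x)\<^sup>2 - 2 * (N * (cmod p)\<^sup>2) + (cmod p * norm y)\<^sup>2"
  proof -
    have "cnj p * p = of_real ((cmod p)\<^sup>2)"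
      by (simp add: complex_norm_square mult.commute del: of_real_power flip: of_real_power)
    then have "cinner (N *\<^sub>R x) (p *\<^sub>C y) = of_real (N * (cmod p)\<^sup>2)"
      by (simp add: cinner_scaleR_left cinner_scaleC_right flip: p_def)
    then show ?thesis
      using N by (simp add: norm_diff_square norm_scaleC power_mult_distrib)
  qed
  also have "\<dots> = N * (N * (norm x)\<^sup>2 - (cmod p)\<^sup>2)"
    by (simp add: N_def algebra_simps power2_eq_square)
  finally have "(cmod p)\<^sup>2 \<le> N * (norm x)\<^sup>2"
    using N by (simp add: zero_le_mult_iff)
  then have "(cmod p)\<^sup>2 \<le> (norm x * norm y)\<^sup>2"
    by (simp add: N_def power_mult_distrib mult.commute)
  then show ?thesis
    unfolding p_def by (rule power2_le_imp_le) simp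
qed simp

lemma bounded_linear_cinner_left: "bounded_linear (\<lambda>x::'a::complex_inner. cinner x y)"
  by (rule bounded_linear_intro[where K = "norm y"])
    (simp_all add: cinner_add_left cinner_scaleR_left cmod_cinner_le scaleR_conv_of_real)

lemma bounded_linear_scaleC: "bounded_linear (\<lambda>x::'a::complex_inner. c *\<^sub>C x)"
  by (rule bounded_linear_intro[where K = "cmod c"])
    (simp_all add: scaleC_add_right scaleR_scaleC scaleC_scaleC norm_scaleC mult.commute)

text \<open>The Lax-Milgram argument.  Coercivity and boundedness give
  \<open>\<parallel>x - t T x\<parallel>\<^sup>2 \<le> (1 - 2 t m + t\<^sup>2 B\<^sup>2) \<parallel>x\<parallel>\<^sup>2\<close>, and \<open>t = m / B\<^sup>2\<close> minimizes the factor.\<close>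

lemma coercive_imp_invertible_op:
  fixes T :: "'a::complex_hilbert_space \<Rightarrow> 'a"
  assumes T: "bounded_clinear T"
    and m: "m > 0"
    and coercive: "\<And>f. m * (norm f)\<^sup>2 \<le> Re (cinner (T f) f)"
  shows "invertible_op T"
proof -
  interpret T: bounded_linear T
    using T by (simp add: bounded_clinear_def)
  have T_scaleC: "T (c *\<^sub>C x) = c *\<^sub>C T x" for c x
    using T by (simp add: bounded_clinear_def)
  obtain B where B: "B > 0" and T_le: "\<And>x. norm (T x) \<le> norm x * B"
    using T.pos_bounded by blast
  define t where "t = m / B\<^sup>2"
  (* The maximum matters only in the zero space, where m may exceed B. *)
  define q where "q = max 0 (1 - m\<^sup>2 / B\<^sup>2)"
  have t: "t > 0" using m B by (simp add: t_def)
  have q: "0 \<le> q" "q < 1" using m B by (simp_all add: q_def)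
  have contraction: "norm (x - t *\<^sub>R T x) \<le> sqrt q * norm x" for x
  proof -
    have "(norm (T x))\<^sup>2 \<le> (norm x * B)\<^sup>2"
      using T_le by (simp add: power_mono)
    then have "t\<^sup>2 * (norm (T x))\<^sup>2 \<le> t\<^sup>2 * (norm x * B)\<^sup>2"
      by (simp add: mult_left_mono)
    moreover have "t * (m * (norm x)\<^sup>2) \<le> t * Re (cinner (T x) x)"
      using coercive t by (simp add: mult_left_mono)
    moreover have "Re (cinner x (t *\<^sub>R T x)) = t * Re (cinner (T x) x)"
      by (subst cinner_commute) (simp add: cinner_scaleR_left)
    ultimately have "(norm (x - t *\<^sub>R T x))\<^sup>2
        \<le> (norm x)\<^sup>2 - 2 * (t * (m * (norm x)\<^sup>2)) + t\<^sup>2 * (norm x * B)\<^sup>2"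
      by (simp add: norm_diff_square power_mult_distrib)
    also have "\<dots> = (1 - m\<^sup>2 / B\<^sup>2) * (norm x)\<^sup>2"
      using B by (simp add: t_def field_simps power2_eq_square)
    also have "\<dots> \<le> q * (norm x)\<^sup>2"
      by (simp add: q_def mult_right_mono)
    also have "\<dots> = (sqrt q * norm x)\<^sup>2"
      using q by (simp add: power_mult_distrib)
    finally show ?thesis
      by (rule power2_le_imp_le) (simp add: q)
  qed
  have surj: "\<exists>x. T x = g" for g
  proof -
    let ?\<Phi> = "\<lambda>x. x - t *\<^sub>R (T x - g)"
    have "dist (?\<Phi> x) (?\<Phi> y) \<le> sqrt q * dist x y" for x y
    proof -
      have "?\<Phi> x - ?\<Phi> y = (x - y) - t *\<^sub>R T (x - y)"
        by (simp add: T.diff algebra_simps)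
      then show ?thesis
        using contraction[of "x - y"] by (metis dist_norm)
    qed
    then have "\<exists>!x. ?\<Phi> x = x"
      using q by (intro banach_fix_type[where c = "sqrt q"]) simp_all
    then obtain x where "?\<Phi> x = x" by blast
    then show ?thesis using t by auto
  qed
  have norm_le: "norm x \<le> norm (T x) * (1 / m)" for x
  proof (cases "x = 0")
    case False
    have "m * (norm x)\<^sup>2 \<le> norm (T x) * norm x"
      using coercive[of x] complex_Re_le_cmod[of "cinner (T x) x"] cmod_cinner_le[of "T x" x]
      by linarith
    then show ?thesis
      using False m by (simp add: power2_eq_square field_simps)
  qed simp
  have inj: "x = y" if "T x = T y" for x y
    using norm_le[of "x - y"] that by (simp add: T.diff)
  define R where "R = (\<lambda>g. SOME x. T x = g)"
  have TR: "T (R g) = g" for g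
    unfolding R_def by (rule someI_ex[OF surj])
  have "bounded_linear R"
  proof (rule bounded_linear_intro[where K = "1 / m"])
    show "R (x + y) = R x + R y" for x y by (rule inj) (simp add: TR T.add)
    show "R (r *\<^sub>R x) = r *\<^sub>R R x" for r x by (rule inj) (simp add: TR T.scaleR)
    show "norm (R x) \<le> norm x * (1 / m)" for x using norm_le[of "R x"] by (simp add: TR)
  qed
  moreover have "R (c *\<^sub>C x) = c *\<^sub>C R x" for c x
    by (rule inj) (simp add: TR T_scaleC)
  moreover have "R (T x) = x" for x
    by (rule inj) (rule TR)
  ultimately show ?thesis
    using T TR unfolding invertible_op_def bounded_clinear_def by blast
qed

section \<open>Bessel sequences and the frame operator\<close>

text \<open>Sequences indexed by the natural numbers suffice, since \<open>enum_terms\<close> pads a finite family with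
  zero vectors, and these contribute nothing to any of the series.\<close>

definition frame_seq :: "(nat \<Rightarrow> 'a::complex_inner) \<Rightarrow> bool"
  where "frame_seq \<phi> \<longleftrightarrow> (\<exists>m M. 0 < m \<and> (\<forall>f.
    summable (\<lambda>k. (cmod (cinner f (\<phi> k)))\<^sup>2) \<and>
    m * (norm f)\<^sup>2 \<le> (\<Sum>k. (cmod (cinner f (\<phi> k)))\<^sup>2) \<and>
    (\<Sum>k. (cmod (cinner f (\<phi> k)))\<^sup>2) \<le> M * (norm f)\<^sup>2))"

text \<open>Nonnegativity of \<open>M\<close> is demanded because in the zero space the inequality holds for every \<open>M\<close>.\<close>

definition bessel_bound :: "(nat \<Rightarrow> 'a::complex_inner) \<Rightarrow> real \<Rightarrow> bool"
  where "bessel_bound \<phi> M \<longleftrightarrow> 0 \<le> M \<and> (\<forall>f.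
    summable (\<lambda>k. (cmod (cinner f (\<phi> k)))\<^sup>2) \<and>
    (\<Sum>k. (cmod (cinner f (\<phi> k)))\<^sup>2) \<le> M * (norm f)\<^sup>2)"

definition frame_operator :: "(nat \<Rightarrow> 'a::complex_inner) \<Rightarrow> 'a \<Rightarrow> 'a"
  where "frame_operator \<phi> f = (\<Sum>k. cinner f (\<phi> k) *\<^sub>C \<phi> k)"

text \<open>By duality: for \<open>g = \<Sum>\<^sub>F c\<^sub>k \<phi>\<^sub>k\<close>, Cauchy-Schwarz bounds \<open>\<parallel>g\<parallel>\<^sup>2 = \<Sum>\<^sub>F c\<^sub>k \<langle>\<phi>\<^sub>k, g\<rangle>\<close> by the
  \<open>\<ell>\<^sup>2\<close> norms of \<open>c\<close> and of the coefficients of \<open>g\<close>; the latter is at most \<open>\<surd>M \<parallel>g\<parallel>\<close>.\<close>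

lemma norm_synthesis_le:
  assumes \<phi>: "bessel_bound \<phi> M" and F: "finite F"
  shows "(norm (\<Sum>k\<in>F. c k *\<^sub>C \<phi> k))\<^sup>2 \<le> M * (\<Sum>k\<in>F. (cmod (c k))\<^sup>2)"
proof -
  define g where "g = (\<Sum>k\<in>F. c k *\<^sub>C \<phi> k)"
  define C where "C = (\<Sum>k\<in>F. (cmod (c k))\<^sup>2)"
  have C: "C \<ge> 0" by (simp add: C_def sum_nonneg)
  have sm: "summable (\<lambda>k. (cmod (cinner g (\<phi> k)))\<^sup>2)"
    and le: "(\<Sum>k. (cmod (cinner g (\<phi> k)))\<^sup>2) \<le> M * (norm g)\<^sup>2"
    using \<phi> by (auto simp: bessel_bound_def)
  have "(\<Sum>k\<in>F. (cmod (cinner g (\<phi> k)))\<^sup>2) \<le> M * (norm g)\<^sup>2"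
    using sum_le_suminf[OF sm F] le by force
  moreover have "(norm g)\<^sup>2 \<le> (\<Sum>k\<in>F. cmod (c k) * cmod (cinner g (\<phi> k)))"
  proof -
    have "(norm g)\<^sup>2 = cmod (cinner g g)"
      by (simp add: cinner_self norm_power)
    also have "cinner g g = (\<Sum>k\<in>F. c k * cinner (\<phi> k) g)"
      by (subst (1) g_def) (simp add: cinner_sum_left cinner_scaleC_left)
    also have "cmod \<dots> \<le> (\<Sum>k\<in>F. cmod (c k * cinner (\<phi> k) g))"
      by (rule norm_sum)
    also have "\<dots> = (\<Sum>k\<in>F. cmod (c k) * cmod (cinner g (\<phi> k)))"
      by (metis (no_types) cinner_commute complex_mod_cnj norm_mult)
    finally show ?thesis .
  qed
  moreover have "(\<Sum>k\<in>F. cmod (c k) * cmod (cinner g (\<phi> k)))\<^sup>2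
      \<le> C * (\<Sum>k\<in>F. (cmod (cinner g (\<phi> k)))\<^sup>2)"
    unfolding C_def by (rule Cauchy_Schwarz_ineq_sum)
  ultimately have "((norm g)\<^sup>2)\<^sup>2 \<le> C * (M * (norm g)\<^sup>2)"
    using C by (smt (verit) mult_left_mono power_mono zero_le_power2)
  then have "(norm g)\<^sup>2 * (norm g)\<^sup>2 \<le> (M * C) * (norm g)\<^sup>2"
    by (simp add: power2_eq_square mult_ac)
  moreover have "0 \<le> M * C"
    using C \<phi> by (simp add: bessel_bound_def)
  ultimately have "(norm g)\<^sup>2 \<le> M * C"
    by (cases "g = 0") (simp, metis mult_right_le_imp_le zero_less_norm_iff zero_less_power)
  then show ?thesis by (simp add: g_def C_def)
qed

lemma bessel_summable_square:
  "bessel_bound \<phi> M \<Longrightarrow> summable (\<lambda>k. (cmod (cinner f (\<phi> k)))\<^sup>2)"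
  by (simp add: bessel_bound_def)

instance complex_hilbert_space \<subseteq> banach ..

text \<open>The synthesis estimate turns Cauchy sums of the coefficient squares into Cauchy sums of vectors.\<close>

lemma bessel_summable_frame_operator:
  fixes \<phi> :: "nat \<Rightarrow> 'a::complex_hilbert_space"
  assumes \<phi>: "bessel_bound \<phi> M"
  shows "summable (\<lambda>k. cinner f (\<phi> k) *\<^sub>C \<phi> k)"
  unfolding summable_Cauchy
proof (intro allI impI)
  fix \<epsilon> :: real assume \<epsilon>: "\<epsilon> > 0"
  let ?a = "\<lambda>k. (cmod (cinner f (\<phi> k)))\<^sup>2"
  have M: "M \<ge> 0" using \<phi> by (simp add: bessel_bound_def)
  then have "\<epsilon>\<^sup>2 / (M + 1) > 0" using \<epsilon> by simp
  then obtain N where N: "\<And>i n. i \<ge> N \<Longrightarrow> norm (sum ?a {i..<n}) < \<epsilon>\<^sup>2 / (M + 1)"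
    using bessel_summable_square[OF \<phi>, of f] unfolding summable_Cauchy by meson
  have "norm (\<Sum>k\<in>{i..<n}. cinner f (\<phi> k) *\<^sub>C \<phi> k) < \<epsilon>" if "i \<ge> N" for i n
  proof -
    have "(norm (\<Sum>k\<in>{i..<n}. cinner f (\<phi> k) *\<^sub>C \<phi> k))\<^sup>2 \<le> M * sum ?a {i..<n}"
      by (rule norm_synthesis_le[OF \<phi>]) simp
    also have "\<dots> \<le> (M + 1) * sum ?a {i..<n}"
      by (simp add: mult_right_mono sum_nonneg)
    also have "\<dots> < (M + 1) * (\<epsilon>\<^sup>2 / (M + 1))"
      using N[OF that, of n] M by (intro mult_strict_left_mono) auto
    also have "\<dots> = \<epsilon>\<^sup>2" using M by simp
    finally show ?thesis
      using \<epsilon> by (simp add: power2_less_imp_less)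
  qed
  then show "\<exists>N. \<forall>i\<ge>N. \<forall>n. norm (\<Sum>k\<in>{i..<n}. cinner f (\<phi> k) *\<^sub>C \<phi> k) < \<epsilon>"
    by blast
qed

lemma norm_frame_operator_square_le:
  assumes \<phi>: "bessel_bound \<phi> M"
    and S: "summable (\<lambda>k. cinner f (\<phi> k) *\<^sub>C \<phi> k)"
  shows "(norm (frame_operator \<phi> f))\<^sup>2 \<le> M * (\<Sum>k. (cmod (cinner f (\<phi> k)))\<^sup>2)"
proof (rule LIMSEQ_le_const2)
  show "(\<lambda>n. (norm (\<Sum>k<n. cinner f (\<phi> k) *\<^sub>C \<phi> k))\<^sup>2) \<longlonglongrightarrow> (norm (frame_operator \<phi> f))\<^sup>2"
    unfolding frame_operator_def by (intro tendsto_intros summable_LIMSEQ S)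
  have "(norm (\<Sum>k<n. cinner f (\<phi> k) *\<^sub>C \<phi> k))\<^sup>2 \<le> M * (\<Sum>k. (cmod (cinner f (\<phi> k)))\<^sup>2)" for n
  proof -
    have "(norm (\<Sum>k<n. cinner f (\<phi> k) *\<^sub>C \<phi> k))\<^sup>2 \<le> M * (\<Sum>k<n. (cmod (cinner f (\<phi> k)))\<^sup>2)"
      by (rule norm_synthesis_le[OF \<phi>]) simp
    also have "\<dots> \<le> M * (\<Sum>k. (cmod (cinner f (\<phi> k)))\<^sup>2)"
      using \<phi> by (intro mult_left_mono sum_le_suminf) (auto simp: bessel_bound_def)
    finally show ?thesis .
  qed
  then show "\<exists>N. \<forall>n\<ge>N. (norm (\<Sum>k<n. cinner f (\<phi> k) *\<^sub>C \<phi> k))\<^sup>2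
      \<le> M * (\<Sum>k. (cmod (cinner f (\<phi> k)))\<^sup>2)"
    by blast
qed

lemma cinner_frame_operator_sums:
  assumes "summable (\<lambda>k. cinner f (\<phi> k) *\<^sub>C \<phi> k)"
  shows "(\<lambda>k. complex_of_real ((cmod (cinner f (\<phi> k)))\<^sup>2)) sums cinner (frame_operator \<phi> f) f"
proof -
  have "(\<lambda>k. cinner (cinner f (\<phi> k) *\<^sub>C \<phi> k) f) sums cinner (frame_operator \<phi> f) f"
    unfolding frame_operator_def
    by (rule bounded_linear.sums[OF bounded_linear_cinner_left]) (rule summable_sums[OF assms])
  moreover have "cinner (cinner f (\<phi> k) *\<^sub>C \<phi> k) f = of_real ((cmod (cinner f (\<phi> k)))\<^sup>2)" for k
    using cinner_commute[of "\<phi> k" f]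
    by (simp add: cinner_scaleC_left complex_norm_square del: of_real_power flip: of_real_power)
  ultimately show ?thesis by simp
qed

lemma
  assumes "summable (\<lambda>k. cinner f (\<phi> k) *\<^sub>C \<phi> k)"
  shows summable_square_coefficients: "summable (\<lambda>k. (cmod (cinner f (\<phi> k)))\<^sup>2)"
    and Re_cinner_frame_operator:
      "Re (cinner (frame_operator \<phi> f) f) = (\<Sum>k. (cmod (cinner f (\<phi> k)))\<^sup>2)"
    and cinner_frame_operator_real: "cinner (frame_operator \<phi> f) f \<in> \<real>"
proof -
  note sums = cinner_frame_operator_sums[OF assms]
  have "(\<lambda>k. (cmod (cinner f (\<phi> k)))\<^sup>2) sums Re (cinner (frame_operator \<phi> f) f)"
    using sums_Re[OF sums] by simp
  then show "summable (\<lambda>k. (cmod (cinner f (\<phi> k)))\<^sup>2)"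
    and "Re (cinner (frame_operator \<phi> f) f) = (\<Sum>k. (cmod (cinner f (\<phi> k)))\<^sup>2)"
    by (simp_all add: sums_iff)
  have "(\<lambda>k. 0) sums Im (cinner (frame_operator \<phi> f) f)"
    using sums_Im[OF sums] by simp
  then show "cinner (frame_operator \<phi> f) f \<in> \<real>"
    by (simp add: sums_iff complex_is_Real_iff)
qed

lemma bounded_clinear_frame_operator:
  fixes \<phi> :: "nat \<Rightarrow> 'a::complex_hilbert_space"
  assumes \<phi>: "bessel_bound \<phi> M"
  shows "bounded_clinear (frame_operator \<phi>)"
proof -
  note S = bessel_summable_frame_operator[OF \<phi>]
  have M: "M \<ge> 0" using \<phi> by (simp add: bessel_bound_def)
  have add: "frame_operator \<phi> (f + g) = frame_operator \<phi> f + frame_operator \<phi> g" for f g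
    by (simp add: frame_operator_def suminf_add S cinner_add_left scaleC_add_left)
  have scaleC: "frame_operator \<phi> (c *\<^sub>C f) = c *\<^sub>C frame_operator \<phi> f" for c f
    using bounded_linear.suminf[OF bounded_linear_scaleC S[of f], of c]
    by (simp add: frame_operator_def cinner_scaleC_left scaleC_scaleC)
  have "norm (frame_operator \<phi> f) \<le> norm f * M" for f
  proof -
    have "(norm (frame_operator \<phi> f))\<^sup>2 \<le> M * (\<Sum>k. (cmod (cinner f (\<phi> k)))\<^sup>2)"
      by (rule norm_frame_operator_square_le[OF \<phi> S])
    also have "\<dots> \<le> M * (M * (norm f)\<^sup>2)"
      using \<phi> M by (intro mult_left_mono) (auto simp: bessel_bound_def)
    also have "\<dots> = (norm f * M)\<^sup>2" by (simp add: power2_eq_square)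
    finally show ?thesis
      by (rule power2_le_imp_le) (simp add: M)
  qed
  then have "bounded_linear (frame_operator \<phi>)"
    by (intro bounded_linear_intro) (simp_all add: add scaleR_scaleC scaleC)
  then show ?thesis
    by (simp add: bounded_clinear_def scaleC)
qed

section \<open>Frames and their frame operators\<close>

lemma frame_seq_imp_frame_operator:
  fixes \<phi> :: "nat \<Rightarrow> 'a::complex_hilbert_space"
  assumes "frame_seq \<phi>"
  shows "(\<forall>f. summable (\<lambda>k. cinner f (\<phi> k) *\<^sub>C \<phi> k)) \<and>
    positive_op (frame_operator \<phi>) \<and> invertible_op (frame_operator \<phi>)"
proof -
  obtain m M where m: "m > 0"
    and sm: "\<And>f. summable (\<lambda>k. (cmod (cinner f (\<phi> k)))\<^sup>2)"
    and lower: "\<And>f. m * (norm f)\<^sup>2 \<le> (\<Sum>k. (cmod (cinner f (\<phi> k)))\<^sup>2)"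
    and upper: "\<And>f. (\<Sum>k. (cmod (cinner f (\<phi> k)))\<^sup>2) \<le> M * (norm f)\<^sup>2"
    using assms unfolding frame_seq_def by blast
  have "(\<Sum>k. (cmod (cinner f (\<phi> k)))\<^sup>2) \<le> max 0 M * (norm f)\<^sup>2" for f
    using upper[of f] mult_right_mono[of M "max 0 M" "(norm f)\<^sup>2"] by simp
  then have \<phi>: "bessel_bound \<phi> (max 0 M)"
    by (simp add: bessel_bound_def sm)
  note S = bessel_summable_frame_operator[OF \<phi>]
  have coercive: "m * (norm f)\<^sup>2 \<le> Re (cinner (frame_operator \<phi> f) f)" for f
    by (simp add: Re_cinner_frame_operator[OF S] lower)
  have "0 < Re (cinner (frame_operator \<phi> f) f)" if "f \<noteq> 0" for f
    using coercive[of f] m that by (smt (verit) mult_pos_pos zero_less_norm_iff zero_less_power)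
  then have "positive_op (frame_operator \<phi>)"
    by (simp add: positive_op_def cinner_frame_operator_real[OF S])
  moreover have "invertible_op (frame_operator \<phi>)"
    by (rule coercive_imp_invertible_op[OF bounded_clinear_frame_operator[OF \<phi>] m coercive])
  ultimately show ?thesis using S by blast
qed

text \<open>Boundedness of \<open>S\<close> gives the Bessel bound because the sum of the coefficient squares is
  \<open>\<langle>S f, f\<rangle>\<close>; this in turn gives \<open>\<parallel>S f\<parallel>\<^sup>2 \<le> B \<langle>S f, f\<rangle>\<close>, which upgrades the lower bound on
  \<open>\<parallel>S f\<parallel>\<close> given by the bounded inverse to one on the quadratic form.\<close>

lemma frame_operator_imp_frame_seq:
  fixes \<phi> :: "nat \<Rightarrow> 'a::complex_inner"
  assumes S: "\<And>f. summable (\<lambda>k. cinner f (\<phi> k) *\<^sub>C \<phi> k)"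
    and inv: "invertible_op (frame_operator \<phi>)"
  shows "frame_seq \<phi>"
proof -
  obtain R where "bounded_linear (frame_operator \<phi>)" "bounded_linear R"
    and R: "\<And>f. R (frame_operator \<phi> f) = f"
    using inv unfolding invertible_op_def bounded_clinear_def by blast
  then obtain B K where B: "B > 0" "\<And>f. norm (frame_operator \<phi> f) \<le> norm f * B"
    and K: "K > 0" "\<And>f. norm (R f) \<le> norm f * K"
    using bounded_linear.pos_bounded by metis
  note sm = summable_square_coefficients[OF S]
  have upper: "(\<Sum>k. (cmod (cinner f (\<phi> k)))\<^sup>2) \<le> B * (norm f)\<^sup>2" for f
  proof -
    have "(\<Sum>k. (cmod (cinner f (\<phi> k)))\<^sup>2) \<le> norm (frame_operator \<phi> f) * norm f"
      using Re_cinner_frame_operator[OF S, of f]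
        complex_Re_le_cmod[of "cinner (frame_operator \<phi> f) f"]
        cmod_cinner_le[of "frame_operator \<phi> f" f] by linarith
    also have "\<dots> \<le> (norm f * B) * norm f"
      by (intro mult_right_mono B(2)) simp
    finally show ?thesis by (simp add: power2_eq_square mult_ac)
  qed
  then have \<phi>: "bessel_bound \<phi> B"
    using B(1) by (simp add: bessel_bound_def sm)
  have lower: "1 / (K\<^sup>2 * B) * (norm f)\<^sup>2 \<le> (\<Sum>k. (cmod (cinner f (\<phi> k)))\<^sup>2)" for f
  proof -
    have "(norm f)\<^sup>2 \<le> (norm (frame_operator \<phi> f) * K)\<^sup>2"
      using K(2)[of "frame_operator \<phi> f"] by (simp add: R power_mono)
    also have "\<dots> \<le> (B * (\<Sum>k. (cmod (cinner f (\<phi> k)))\<^sup>2)) * K\<^sup>2"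
      unfolding power_mult_distrib
      by (intro mult_right_mono norm_frame_operator_square_le[OF \<phi> S]) simp
    finally show ?thesis
      using K(1) B(1) by (simp add: field_simps)
  qed
  show ?thesis
    unfolding frame_seq_def
    by (rule exI[of _ "1 / (K\<^sup>2 * B)"], rule exI[of _ B]) (use K(1) B(1) sm lower upper in simp)
qed

theorem frame_seq_iff_frame_operator:
  fixes \<phi> :: "nat \<Rightarrow> 'a::complex_hilbert_space"
  shows "frame_seq \<phi> \<longleftrightarrow> (\<forall>f. summable (\<lambda>k. cinner f (\<phi> k) *\<^sub>C \<phi> k)) \<and>
    positive_op (frame_operator \<phi>) \<and> invertible_op (frame_operator \<phi>)"
  using frame_seq_imp_frame_operator frame_operator_imp_frame_seq by blast

section \<open>Weights\<close>

lemma frame_seq_compare: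
  assumes frame: "frame_seq \<phi>" and a: "a > 0"
    and lower: "\<And>f k. a * (cmod (cinner f (\<phi> k)))\<^sup>2 \<le> (cmod (cinner f (\<phi>' k)))\<^sup>2"
    and upper: "\<And>f k. (cmod (cinner f (\<phi>' k)))\<^sup>2 \<le> b * (cmod (cinner f (\<phi> k)))\<^sup>2"
    and b: "b > 0"
  shows "frame_seq \<phi>'"
proof -
  let ?s = "\<lambda>f k. (cmod (cinner f (\<phi> k)))\<^sup>2"
  let ?s' = "\<lambda>f k. (cmod (cinner f (\<phi>' k)))\<^sup>2"
  obtain m M where m: "m > 0" and sm: "\<And>f. summable (?s f)"
    and m_le: "\<And>f. m * (norm f)\<^sup>2 \<le> suminf (?s f)"
    and le_M: "\<And>f. suminf (?s f) \<le> M * (norm f)\<^sup>2"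
    using frame unfolding frame_seq_def by blast
  have sm': "summable (?s' f)" for f
    by (rule summable_comparison_test[OF _ summable_mult[OF sm[of f], of b]]) (use upper in auto)
  have "(a * m) * (norm f)\<^sup>2 \<le> suminf (?s' f)" for f
  proof -
    have "(a * m) * (norm f)\<^sup>2 \<le> a * suminf (?s f)"
      using a m_le by simp
    also have "\<dots> = (\<Sum>k. a * ?s f k)"
      by (rule suminf_mult[symmetric, OF sm])
    also have "\<dots> \<le> suminf (?s' f)"
      by (intro suminf_le lower summable_mult sm sm')
    finally show ?thesis .
  qed
  moreover have "suminf (?s' f) \<le> (b * M) * (norm f)\<^sup>2" for f
  proof -
    have "suminf (?s' f) \<le> (\<Sum>k. b * ?s f k)"
      by (intro suminf_le upper summable_mult sm sm')
    also have "\<dots> = b * suminf (?s f)"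
      by (rule suminf_mult[OF sm])
    also have "\<dots> \<le> (b * M) * (norm f)\<^sup>2"
      using b le_M by simp
    finally show ?thesis .
  qed
  ultimately show ?thesis
    unfolding frame_seq_def using a m sm'
    by (intro exI[of _ "a * m"] exI[of _ "b * M"]) simp
qed

lemma is_frame_iff_frame_seq: "is_frame e \<Gamma> \<psi> \<longleftrightarrow> frame_seq (enum_terms e \<Gamma> \<psi>)"
proof -
  have "enum_terms e \<Gamma> (\<lambda>n. (cmod (cinner f (\<psi> n)))\<^sup>2)
      = (\<lambda>k. (cmod (cinner f (enum_terms e \<Gamma> \<psi> k)))\<^sup>2)" for f
    by (auto simp: enum_terms_def fun_eq_iff)
  then show ?thesis
    by (simp add: is_frame_def frame_seq_def summable_enum_def suminf_enum_def)
qed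

lemma enumerates_in: "enumerates e \<Gamma> \<Longrightarrow> k \<in> enum_dom \<Gamma> \<Longrightarrow> e k \<in> \<Gamma>"
  unfolding enumerates_def by (auto dest: bij_betwE)

text \<open>Such scalars change every term \<open>\<bar>\<langle>f, \<psi>\<^sub>n\<rangle>\<bar>\<^sup>2\<close> by a factor between two positive constants, and
  the inverse factors are bounded in the same way; hence the equivalence.\<close>

lemma is_frame_scale_semi_normalized:
  fixes c :: "'i \<Rightarrow> complex"
  assumes e: "enumerates e \<Gamma>" and c: "semi_normalized \<Gamma> c"
  shows "is_frame e \<Gamma> (\<lambda>n. c n *\<^sub>C \<psi> n) \<longleftrightarrow> is_frame e \<Gamma> \<psi>"
proof -
  obtain a b where a: "0 < a" and ab: "a \<le> b"
    and c_bounds: "\<And>n. n \<in> \<Gamma> \<Longrightarrow> a \<le> cmod (c n) \<and> cmod (c n) \<le> b"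
    using c unfolding semi_normalized_def by blast
  let ?\<phi> = "enum_terms e \<Gamma> \<psi>"
  let ?\<phi>' = "enum_terms e \<Gamma> (\<lambda>n. c n *\<^sub>C \<psi> n)"
  have b: "0 < b" using a ab by simp
  have lower: "a\<^sup>2 * (cmod (cinner f (?\<phi> k)))\<^sup>2 \<le> (cmod (cinner f (?\<phi>' k)))\<^sup>2"
    and upper: "(cmod (cinner f (?\<phi>' k)))\<^sup>2 \<le> b\<^sup>2 * (cmod (cinner f (?\<phi> k)))\<^sup>2" for f k
    using c_bounds[OF enumerates_in[OF e, of k]] a
    by (auto simp: enum_terms_def cinner_scaleC_right norm_mult power_mult_distrib
        intro!: mult_right_mono power_mono)
  have "frame_seq ?\<phi> \<Longrightarrow> frame_seq ?\<phi>'"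
    by (rule frame_seq_compare[where a = "a\<^sup>2" and b = "b\<^sup>2"]) (use a b lower upper in simp_all)
  moreover have "frame_seq ?\<phi>' \<Longrightarrow> frame_seq ?\<phi>"
    by (rule frame_seq_compare[where a = "1 / b\<^sup>2" and b = "1 / a\<^sup>2"])
      (use a b lower upper in \<open>simp_all add: field_simps\<close>)
  ultimately show ?thesis
    unfolding is_frame_iff_frame_seq by blast
qed

lemma semi_normalized_of_real:
  "semi_normalized \<Gamma> w \<Longrightarrow> semi_normalized \<Gamma> (\<lambda>n. complex_of_real (w n))"
  by (simp add: semi_normalized_def)

lemma semi_normalized_sqrt:
  assumes "semi_normalized \<Gamma> w"
  shows "semi_normalized \<Gamma> (\<lambda>n. sqrt (w n))"
proof -
  obtain a b where "0 < a" "a \<le> b" "\<And>n. n \<in> \<Gamma> \<Longrightarrow> a \<le> \<bar>w n\<bar> \<and> \<bar>w n\<bar> \<le> b"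
    using assms unfolding semi_normalized_def by auto
  then show ?thesis
    unfolding semi_normalized_def
    by (intro exI[of _ "sqrt a"] exI[of _ "sqrt b"]) (simp flip: real_sqrt_abs2 add: real_sqrt_abs')
qed

lemma multiplier_positive_invertible_iff_is_frame_sqrt:
  fixes \<psi> :: "'i \<Rightarrow> 'a::complex_hilbert_space"
  assumes e: "enumerates e \<Gamma>" and w: "positive_seq \<Gamma> w"
  shows "multiplier_positive_invertible e \<Gamma> (\<lambda>n. complex_of_real (w n)) \<psi>
    \<longleftrightarrow> is_frame e \<Gamma> (\<lambda>n. complex_of_real (sqrt (w n)) *\<^sub>C \<psi> n)"
proof -
  let ?\<phi> = "enum_terms e \<Gamma> (\<lambda>n. complex_of_real (sqrt (w n)) *\<^sub>C \<psi> n)"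
  have terms: "enum_terms e \<Gamma> (multiplier_terms (\<lambda>n. complex_of_real (w n)) \<psi> f)
      = (\<lambda>k. cinner f (?\<phi> k) *\<^sub>C ?\<phi> k)" for f
  proof
    fix k
    show "enum_terms e \<Gamma> (multiplier_terms (\<lambda>n. complex_of_real (w n)) \<psi> f) k
        = cinner f (?\<phi> k) *\<^sub>C ?\<phi> k"
    proof (cases "k \<in> enum_dom \<Gamma>")
      case True
      then have "w (e k) > 0"
        using enumerates_in[OF e] w by (simp add: positive_seq_def)
      then have "complex_of_real (sqrt (w (e k))) * complex_of_real (sqrt (w (e k)))
          = complex_of_real (w (e k))"
        by (simp flip: of_real_mult)
      then show ?thesis
        using True
        by (simp add: enum_terms_def multiplier_terms_def cinner_scaleC_right scaleC_scaleC mult_ac)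
    next
      case False
      have "c *\<^sub>C (0::'a) = 0" for c
        using scaleC_add_right[of c 0 "0::'a"] by simp
      then show ?thesis
        using False by (simp add: enum_terms_def)
    qed
  qed
  have "multiplier e \<Gamma> (\<lambda>n. complex_of_real (w n)) \<psi> = frame_operator ?\<phi>"
    by (simp add: multiplier_def suminf_enum_def frame_operator_def terms fun_eq_iff)
  then show ?thesis
    by (simp add: multiplier_positive_invertible_def multiplier_converges_def summable_enum_def
        terms is_frame_iff_frame_seq frame_seq_iff_frame_operator)
qed

lemma is_w_frame_iff_is_frame_sqrt:
  assumes e: "enumerates e \<Gamma>" and w: "positive_seq \<Gamma> w"
  shows "is_w_frame e \<Gamma> w \<psi> \<longleftrightarrow> is_frame e \<Gamma> (\<lambda>n. complex_of_real (sqrt (w n)) *\<^sub>C \<psi> n)"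
proof -
  have "enum_terms e \<Gamma> (\<lambda>n. w n * (cmod (cinner f (\<psi> n)))\<^sup>2)
      = enum_terms e \<Gamma> (\<lambda>n. (cmod (cinner f (complex_of_real (sqrt (w n)) *\<^sub>C \<psi> n)))\<^sup>2)" for f
    using enumerates_in[OF e] w
    by (auto simp: enum_terms_def fun_eq_iff positive_seq_def cinner_scaleC_right norm_mult
        power_mult_distrib less_imp_le)
  then show ?thesis
    by (simp add: is_w_frame_def is_frame_def summable_enum_def suminf_enum_def)
qed

theorem theorem4p5:
  fixes \<Gamma> :: "'i set"
    and e :: "nat \<Rightarrow> 'i"
    and \<psi> :: "'i \<Rightarrow> 'a::complex_hilbert_space"
    and w :: "'i \<Rightarrow> real"
  assumes "separable (UNIV :: 'a set)"
    and "countable \<Gamma>"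
    and "enumerates e \<Gamma>"
    and "positive_seq \<Gamma> w"
    and "semi_normalized \<Gamma> w"
  shows
    "(is_frame e \<Gamma> \<psi> \<longleftrightarrow>
        multiplier_positive_invertible e \<Gamma> (\<lambda>n. complex_of_real (w n)) \<psi>) \<and>
     (is_frame e \<Gamma> \<psi> \<longleftrightarrow> is_w_frame e \<Gamma> w \<psi>) \<and>
     (is_frame e \<Gamma> \<psi> \<longleftrightarrow> is_frame e \<Gamma> (\<lambda>n. complex_of_real (sqrt (w n)) *\<^sub>C \<psi> n)) \<and>
     (is_frame e \<Gamma> \<psi> \<longleftrightarrow>
        (\<forall>w' :: 'i \<Rightarrow> real. positive_seq \<Gamma> w' \<and> semi_normalized \<Gamma> w' \<longrightarrow>
          multiplier_positive_invertible e \<Gamma> (\<lambda>n. complex_of_real (w' n)) \<psi>)) \<and>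
     (is_frame e \<Gamma> \<psi> \<longleftrightarrow> is_frame e \<Gamma> (\<lambda>n. complex_of_real (w n) *\<^sub>C \<psi> n))"
proof -
  note e = assms(3) and w = assms(4,5)
  have sqrt_frame: "is_frame e \<Gamma> (\<lambda>n. complex_of_real (sqrt (v n)) *\<^sub>C \<psi> n) \<longleftrightarrow> is_frame e \<Gamma> \<psi>"
    if "semi_normalized \<Gamma> v" for v
    by (rule is_frame_scale_semi_normalized[OF e])
      (rule semi_normalized_of_real[OF semi_normalized_sqrt[OF that]])
  have mult: "multiplier_positive_invertible e \<Gamma> (\<lambda>n. complex_of_real (v n)) \<psi> \<longleftrightarrow> is_frame e \<Gamma> \<psi>"
    if "positive_seq \<Gamma> v" "semi_normalized \<Gamma> v" for v
    by (simp add: multiplier_positive_invertible_iff_is_frame_sqrt[OF e that(1)] sqrt_frame that(2))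
  show ?thesis
    using w mult sqrt_frame[OF w(2)] is_w_frame_iff_is_frame_sqrt[OF e w(1)]
      is_frame_scale_semi_normalized[OF e semi_normalized_of_real[OF w(2)]]
    by blast
qed

end
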